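(* Let $\Sigma^{\mathcal H}$ be a conservative hybrid dynamical system with hybrid first integral $\mathcal H=\{H_i\}_{i=1}^m$ and Poincaré map $\boldsymbol P$, and let $\tilde{\boldsymbol P}$ be the Poincaré map of the one-parameter family $\Sigma_\xi$, $\xi\in\mathbb R$, obtained by replacing each phase vector field $\boldsymbol f_i$ by $\tilde{\boldsymbol f}_i=\boldsymbol f_i+\xi\,(\mathrm dH_i)^{\mathrm T}$. Then a tuple $(\boldsymbol x_0,\xi)$ is a fixed point of $\tilde{\boldsymbol P}$, i.e. $\tilde{\boldsymbol P}(\boldsymbol x_0,\xi)=\boldsymbol x_0$, if and only if $\xi=0$ and $\boldsymbol x_0$ is a fixed point of $\boldsymbol P$, i.e. $\boldsymbol P(\boldsymbol x_0)=\boldsymbol x_0$.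
   Context: **Hybrid dynamical system.** $\Sigma=(\mathcal X,\mathcal F,\mathcal E,\mathcal D)$ has $m\in\mathbb N$ phases $i=1,\dots,m$ traversed in the fixed cyclic order $1\to2\to\dots\to m\to1$ (indices modulo $m$, $m+1=1$). For each $i$: $\mathcal X_i\subseteq\mathbb R^{n_i}$ is open and connected; the phase dynamics are $\dot{\boldsymbol x}_i=\boldsymbol f_i(\boldsymbol x_i)$ with $\boldsymbol f_i\in C^1$ and phase flow $\boldsymbol\varphi_i(t,\bar{\boldsymbol x}_i)$ on a maximal interval $[0,t_i^{\max})$; $e_i^{i+1}:\mathcal X_i\to\mathbb R$ is $C^1$ (event function), and $\mathcal E_i^{i+1}=\{\boldsymbol x_i\in\mathcal X_i: e_i^{i+1}(\boldsymbol x_i)=0,\ \dot e_i^{i+1}(\boldsymbol x_i)=\mathrm d e_i^{i+1}(\boldsymbol x_i)\boldsymbol f_i(\boldsymbol x_i)<0\}$ is the event manifold (with $\mathrm d e_i^{i+1}\neq0$ on it); $\boldsymbol\Delta_i^{i+1}:\mathcal E_i^{i+1}\to\mathcal X_{i+1}$ is a $C^1$ reset map. Derivatives of scalar functions are row vectors. The time-to-event function is $t_i^{\mathcal E}(\bar{\boldsymbol x}_i)=\inf\{t\ge0:\boldsymbol\varphi_i(t,\bar{\boldsymbol x}_i)\in\mathcal E_i^{i+1}\}$ ($\inf\emptyset=\infty$). **Recurrent hybrid trajectory.** For $\boldsymbol x_0\in\mathcal X_1$ put $\bar{\boldsymbol x}_1=\boldsymbol x_0$, $\bar{\boldsymbol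 x}_{i+1}=\boldsymbol\Delta_i^{i+1}(\boldsymbol\varphi_i(t_i^{\mathcal E}(\bar{\boldsymbol x}_i),\bar{\boldsymbol x}_i))$ for $i=1,\dots,m$, $t^{\mathcal E}=\sum_{i=1}^m t_i^{\mathcal E}(\bar{\boldsymbol x}_i)$, and $\boldsymbol x(t)=\boldsymbol\varphi_1(t-t^{\mathcal E},\bar{\boldsymbol x}_{m+1})$ for $t\in\mathcal T=[t^{\mathcal E},t^{\mathcal E}+t_1^{\mathcal E}(\bar{\boldsymbol x}_{m+1}))$. Standing assumptions: (As1) it is unique in forward time and $t_i^{\mathcal E}(\bar{\boldsymbol x}_i)<t_i^{\max}$ (finite) in each phase; (As2) it intersects each $\mathcal E_i^{i+1}$ transversally; (As3) $\overline{\boldsymbol\Delta_i^{i+1}(\mathcal E_i^{i+1})}\cap\mathcal E_{i+1}^{i+2}=\emptyset$ for all phases (so in particular every phase $i=1,\dots,m$ is traversed with duration $t_i^{\mathcal E}>0$). The recurrent hybrid flow is $\boldsymbol\varphi(t,\boldsymbol x_0)=\boldsymbol x(t)$, defined for $\boldsymbol x_0$ in a neighborhood $\mathcal X_0\subset\mathcal X_1$. **Conservative system.** $\Sigma$ is conservative with hybrid first integral $\mathcal H=\{H_i\}_{i=1}^m$ (written $\Sigma^{\mathcal H}$) if (Df1) each $H_i:\mathcal X_i\to\mathbb R$ is a $C^1$ non-trivial first integral of $\dot{\boldsymbol x}_i=\boldsymbol f_i(\boldsymbol x_i)$ (constant along solutions, so $\mathrm dH_i\,\boldsymbol f_i=0$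 on $\mathcal X_i$; trivial means constant, $\mathrm dH_i\equiv\boldsymbol 0$), and (Df2) $H_{i+1}(\boldsymbol\Delta_i^{i+1}(\boldsymbol x_i^-))=H_i(\boldsymbol x_i^-)$ for all $\boldsymbol x_i^-\in\mathcal E_i^{i+1}$, $i=1,\dots,m$ (with $H_{m+1}=H_1$). **Poincaré map $\boldsymbol P$.** Let $a:\mathcal X_1\to\mathbb R$ be $C^1$ (anchor; not identical to an event) and $\mathcal A=\{\boldsymbol x_1\in\mathcal X_1: a(\boldsymbol x_1)=0,\ \mathrm da(\boldsymbol x_1)\boldsymbol f_1(\boldsymbol x_1)<0\}$. Put $t_{m+1}^{\mathcal A}(\bar{\boldsymbol x}_{m+1})=\inf\{t\ge0:\boldsymbol\varphi_1(t,\bar{\boldsymbol x}_{m+1})\in\mathcal A\}$ and $t^{\mathcal A}(\boldsymbol x_0)=t_{m+1}^{\mathcal A}(\bar{\boldsymbol x}_{m+1})+t^{\mathcal E}$, assumed finite (and in $\mathcal T$). Then $\boldsymbol P(\boldsymbol x_0)=\boldsymbol\varphi(t^{\mathcal A}(\boldsymbol x_0),\boldsymbol x_0)\in\mathcal A$ for $\boldsymbol x_0\in\mathcal A_0=\mathcal A\cap\mathcal X_0$. **Modified map $\tilde{\boldsymbol P}$.** For $\xi\in\mathbb R$ let $\Sigma_\xi=(\mathcal X,\tilde{\mathcal F},\mathcal E,\mathcal D)$ be the hybrid system with the same domains, event manifolds and reset maps as $\Sigma^{\mathcal H}$, but with phase dynamics $\dot{\boldsymbol x}_i=\tilde{\boldsymbol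 f}_i(\boldsymbol x_i,\xi)=\boldsymbol f_i(\boldsymbol x_i)+\xi\,\mathrm dH_i(\boldsymbol x_i)^{\mathrm T}$, $i=1,\dots,m$. Let $\boldsymbol\varphi_i(t,\bar{\boldsymbol x}_i;\xi)$ be the flow of $\tilde{\boldsymbol f}_i(\cdot,\xi)$ and $t_i^{\mathcal E}(\bar{\boldsymbol x}_i;\xi)=\inf\{t\ge0:\boldsymbol\varphi_i(t,\bar{\boldsymbol x}_i;\xi)\in\mathcal E_i^{i+1}\}$. With $\bar{\boldsymbol x}_1=\boldsymbol x_0$ and $\bar{\boldsymbol x}_{i+1}=\boldsymbol\Delta_i^{i+1}(\boldsymbol\varphi_i(t_i^{\mathcal E}(\bar{\boldsymbol x}_i;\xi),\bar{\boldsymbol x}_i;\xi))$ for $i=1,\dots,m$ (these points now depend on $\xi$), the recurrent hybrid flow of $\Sigma_\xi$ is $\boldsymbol\varphi(t,\boldsymbol x_0;\xi)=\boldsymbol\varphi_1(t-\sum_{i=1}^m t_i^{\mathcal E}(\bar{\boldsymbol x}_i;\xi),\bar{\boldsymbol x}_{m+1};\xi)$, and its accumulated time to $\mathcal A$ is $t^{\mathcal A}=t^{\mathcal A}(\boldsymbol x_0,\xi)=\inf\{t\ge0:\boldsymbol\varphi_1(t,\bar{\boldsymbol x}_{m+1};\xi)\in\mathcal A\}+\sum_{i=1}^m t_i^{\mathcal E}(\bar{\boldsymbol x}_i;\xi)$, with the same standing assumptions As1-As3 on the trajectories of $\Sigma_\xi$ considered. Then $\tilde{\boldsymbol P}(\boldsymbol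 x_0,\xi)=\boldsymbol\varphi(t^{\mathcal A},\boldsymbol x_0;\xi)$, so $\Sigma_0=\Sigma^{\mathcal H}$ and $\tilde{\boldsymbol P}(\cdot,0)=\boldsymbol P$.
   Formalization: The formal theorem additionally assumes that dH_i is nonzero at some point of the trajectory of Σ_ξ from x_0 to its arrival in A; with H_i merely non-constant the claim fails (H=y², f=(1,0), reset (1,y)→(0,y), on y=0). *)

theory Defs
  imports "HOL-Analysis.Analysis"
begin

section \<open>Calculus on relatively open sets\<close>

text \<open>
  The phases of a hybrid system have state spaces R^(n_i) of different dimensions. They are
  represented as linear subspaces V_i of one Euclidean space 'a with dim V_i = n_i, which is
  no restriction since DIM('a) is arbitrary. Open subsets of R^(n_i) are the sets open relative
  to V_i, and all derivatives are taken within the domain.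
\<close>

text \<open>
  Besides relatively open sets, \<open>C1_on\<close> is also used on an event manifold S, an embedded C^1
  submanifold of codimension one: there D fixes the differential on the tangent space only, is
  arbitrary on a complement, and the definition agrees with being C^1 in charts of S.
\<close>

definition C1_on ::
  "'a::euclidean_space set \<Rightarrow> ('a \<Rightarrow> 'b::real_normed_vector) \<Rightarrow> bool" where
  "C1_on S g \<longleftrightarrow>
    (\<exists>D :: 'a \<Rightarrow> 'a \<Rightarrow>\<^sub>L 'b. continuous_on S D \<and>
      (\<forall>x\<in>S. (g has_derivative blinfun_apply (D x)) (at x within S)))"

text \<open>
  The transposed differential of g at x; the row vector dg(x) acts as
  \<open>\<lambda>h. gradient V S g x \<bullet> h\<close>. If S is open in V and g is differentiable at x, the requirement
  that the vector lies in V makes it unique.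
\<close>

definition gradient ::
  "'a::euclidean_space set \<Rightarrow> 'a set \<Rightarrow> ('a \<Rightarrow> real) \<Rightarrow> 'a \<Rightarrow> 'a" where
  "gradient V S g x = (THE v. v \<in> V \<and> (g has_derivative (\<lambda>h. v \<bullet> h)) (at x within S))"


section \<open>Hybrid systems\<close>

text \<open>
  Phases are numbered 0, ..., m - 1 instead of 1, ..., m. The event manifolds are part of the
  system as sets, so that the vector fields can be changed while the manifolds are kept.
\<close>

record 'a hds =
  phases :: nat
  space :: "nat \<Rightarrow> 'a set"
  dom :: "nat \<Rightarrow> 'a set"
  vf :: "nat \<Rightarrow> 'a \<Rightarrow> 'a"
  event :: "nat \<Rightarrow> 'a set"
  reset :: "nat \<Rightarrow> 'a \<Rightarrow> 'a"

definition next_phase :: "'a hds \<Rightarrow> nat \<Rightarrow> nat" where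
  "next_phase \<Sigma> i = Suc i mod phases \<Sigma>"

definition grad :: "'a::euclidean_space hds \<Rightarrow> nat \<Rightarrow> ('a \<Rightarrow> real) \<Rightarrow> 'a \<Rightarrow> 'a" where
  "grad \<Sigma> i g = gradient (space \<Sigma> i) (dom \<Sigma> i) g"

definition decreasing_zeros :: "'a::euclidean_space hds \<Rightarrow> nat \<Rightarrow> ('a \<Rightarrow> real) \<Rightarrow> 'a set" where
  "decreasing_zeros \<Sigma> i g = {x \<in> dom \<Sigma> i. g x = 0 \<and> grad \<Sigma> i g x \<bullet> vf \<Sigma> i x < 0}"

text \<open>
  Well-formedness with event functions e. On the event manifolds the differential of \<open>e i\<close> is
  automatically nonzero, by the strict inequality in \<open>decreasing_zeros\<close>.
\<close>

definition hybrid_system :: "'a::euclidean_space hds \<Rightarrow> (nat \<Rightarrow> 'a \<Rightarrow> real) \<Rightarrow> bool" where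
  "hybrid_system \<Sigma> e \<longleftrightarrow>
    phases \<Sigma> \<ge> 1 \<and>
    (\<forall>i < phases \<Sigma>.
      subspace (space \<Sigma> i) \<and>
      openin (top_of_set (space \<Sigma> i)) (dom \<Sigma> i) \<and>
      connected (dom \<Sigma> i) \<and>
      vf \<Sigma> i ` dom \<Sigma> i \<subseteq> space \<Sigma> i \<and>
      C1_on (dom \<Sigma> i) (vf \<Sigma> i) \<and>
      C1_on (dom \<Sigma> i) (e i) \<and>
      event \<Sigma> i = decreasing_zeros \<Sigma> i (e i) \<and>
      reset \<Sigma> i ` event \<Sigma> i \<subseteq> dom \<Sigma> (next_phase \<Sigma> i) \<and>
      C1_on (event \<Sigma> i) (reset \<Sigma> i))"

definition resets_avoid_events :: "'a::euclidean_space hds \<Rightarrow> bool" where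
  "resets_avoid_events \<Sigma> \<longleftrightarrow>
    (\<forall>i < phases \<Sigma>. closure (reset \<Sigma> i ` event \<Sigma> i) \<inter> event \<Sigma> (next_phase \<Sigma> i) = {})"


section \<open>Flows and the recurrent hybrid trajectory\<close>

definition solution ::
  "'a::euclidean_space hds \<Rightarrow> nat \<Rightarrow> 'a \<Rightarrow> real \<Rightarrow> (real \<Rightarrow> 'a) \<Rightarrow> bool" where
  "solution \<Sigma> i x T u \<longleftrightarrow>
    0 < T \<and> u 0 = x \<and>
    (\<forall>t\<in>{0..<T}. u t \<in> dom \<Sigma> i \<and>
      (u has_vector_derivative vf \<Sigma> i (u t)) (at t within {0..<T}))"

definition max_time :: "'a::euclidean_space hds \<Rightarrow> nat \<Rightarrow> 'a \<Rightarrow> ereal" where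
  "max_time \<Sigma> i x = (SUP T\<in>{T. \<exists>u. solution \<Sigma> i x T u}. ereal T)"

text \<open>
  The flow is meaningful where solutions are unique. Uniqueness is a separate condition because
  a modified vector field f + xi dH^T with H only of class C^1 need not be Lipschitz.
\<close>

definition flow :: "'a::euclidean_space hds \<Rightarrow> nat \<Rightarrow> real \<Rightarrow> 'a \<Rightarrow> 'a" where
  "flow \<Sigma> i t x = (THE v. \<exists>T u. solution \<Sigma> i x T u \<and> t < T \<and> v = u t)"

definition unique_until :: "'a::euclidean_space hds \<Rightarrow> nat \<Rightarrow> 'a \<Rightarrow> ereal \<Rightarrow> bool" where
  "unique_until \<Sigma> i x \<tau> \<longleftrightarrow>
    (\<forall>T u T' u' t. solution \<Sigma> i x T u \<and> solution \<Sigma> i x T' u' \<and>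
      0 \<le> t \<and> t < T \<and> t < T' \<and> ereal t \<le> \<tau> \<longrightarrow> u t = u' t)"

definition hit_time :: "'a::euclidean_space hds \<Rightarrow> nat \<Rightarrow> 'a set \<Rightarrow> 'a \<Rightarrow> ereal" where
  "hit_time \<Sigma> i S x =
    (INF t\<in>{t. 0 \<le> t \<and> ereal t < max_time \<Sigma> i x \<and> flow \<Sigma> i t x \<in> S}. ereal t)"

definition event_time :: "'a::euclidean_space hds \<Rightarrow> nat \<Rightarrow> 'a \<Rightarrow> ereal" where
  "event_time \<Sigma> i x = hit_time \<Sigma> i (event \<Sigma> i) x"

definition event_state :: "'a::euclidean_space hds \<Rightarrow> nat \<Rightarrow> 'a \<Rightarrow> 'a" where
  "event_state \<Sigma> i x = flow \<Sigma> i (real_of_ereal (event_time \<Sigma> i x)) x"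

text \<open>
  Initial states of the successive phases; \<open>phase_start \<Sigma> x0 (phases \<Sigma>)\<close> lies in phase 0 again.
\<close>

primrec phase_start :: "'a::euclidean_space hds \<Rightarrow> 'a \<Rightarrow> nat \<Rightarrow> 'a" where
  "phase_start \<Sigma> x0 0 = x0"
| "phase_start \<Sigma> x0 (Suc i) = reset \<Sigma> i (event_state \<Sigma> i (phase_start \<Sigma> x0 i))"

definition return_state :: "'a::euclidean_space hds \<Rightarrow> 'a \<Rightarrow> 'a" where
  "return_state \<Sigma> x0 = phase_start \<Sigma> x0 (phases \<Sigma>)"

definition total_event_time :: "'a::euclidean_space hds \<Rightarrow> 'a \<Rightarrow> ereal" where
  "total_event_time \<Sigma> x0 = (\<Sum>i<phases \<Sigma>. event_time \<Sigma> i (phase_start \<Sigma> x0 i))"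

definition recurrent_flow :: "'a::euclidean_space hds \<Rightarrow> real \<Rightarrow> 'a \<Rightarrow> 'a" where
  "recurrent_flow \<Sigma> t x0 =
    flow \<Sigma> 0 (t - real_of_ereal (total_event_time \<Sigma> x0)) (return_state \<Sigma> x0)"


section \<open>Poincare map\<close>

definition anchor :: "'a::euclidean_space hds \<Rightarrow> (nat \<Rightarrow> 'a \<Rightarrow> real) \<Rightarrow> ('a \<Rightarrow> real) \<Rightarrow> bool" where
  "anchor \<Sigma> e a \<longleftrightarrow> C1_on (dom \<Sigma> 0) a \<and> \<not> (\<forall>x \<in> dom \<Sigma> 0. a x = e 0 x)"

definition anchor_set :: "'a::euclidean_space hds \<Rightarrow> ('a \<Rightarrow> real) \<Rightarrow> 'a set" where
  "anchor_set \<Sigma> a = decreasing_zeros \<Sigma> 0 a"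

definition anchor_time :: "'a::euclidean_space hds \<Rightarrow> 'a set \<Rightarrow> 'a \<Rightarrow> ereal" where
  "anchor_time \<Sigma> A x0 = hit_time \<Sigma> 0 A (return_state \<Sigma> x0) + total_event_time \<Sigma> x0"

definition poincare_map :: "'a::euclidean_space hds \<Rightarrow> 'a set \<Rightarrow> 'a \<Rightarrow> 'a" where
  "poincare_map \<Sigma> A x0 = recurrent_flow \<Sigma> (real_of_ereal (anchor_time \<Sigma> A x0)) x0"

text \<open>
  The conditions on a single trajectory under which the Poincare map is defined at x0: uniqueness
  in forward time, events reached before the end of the maximal interval (hence in finite time),
  transversal intersection with every event manifold, positive duration of every phase, and
  arrival in A before the next event. Transversality is stated with the vector field of \<open>\<Sigma>\<close>,
  since in a modified system the event manifold is defined by the original one.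
\<close>

definition poincare_defined ::
  "'a::euclidean_space hds \<Rightarrow> (nat \<Rightarrow> 'a \<Rightarrow> real) \<Rightarrow> 'a set \<Rightarrow> 'a \<Rightarrow> bool" where
  "poincare_defined \<Sigma> e A x0 \<longleftrightarrow>
    x0 \<in> A \<and>
    (\<forall>i < phases \<Sigma>.
      let x = phase_start \<Sigma> x0 i; y = event_state \<Sigma> i x in
        unique_until \<Sigma> i x (event_time \<Sigma> i x) \<and>
        0 < event_time \<Sigma> i x \<and> event_time \<Sigma> i x < max_time \<Sigma> i x \<and>
        y \<in> event \<Sigma> i \<and> grad \<Sigma> i (e i) y \<bullet> vf \<Sigma> i y \<noteq> 0) \<and>
    unique_until \<Sigma> 0 (return_state \<Sigma> x0) (event_time \<Sigma> 0 (return_state \<Sigma> x0)) \<and>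
    anchor_time \<Sigma> A x0 < total_event_time \<Sigma> x0 + event_time \<Sigma> 0 (return_state \<Sigma> x0) \<and>
    poincare_map \<Sigma> A x0 \<in> A"


section \<open>Conservative systems and their modification\<close>

definition first_integral ::
  "'a::euclidean_space hds \<Rightarrow> nat \<Rightarrow> ('a \<Rightarrow> real) \<Rightarrow> bool" where
  "first_integral \<Sigma> i h \<longleftrightarrow>
    C1_on (dom \<Sigma> i) h \<and>
    (\<forall>x T u. solution \<Sigma> i x T u \<longrightarrow> (\<forall>t\<in>{0..<T}. h (u t) = h x)) \<and>
    (\<forall>x \<in> dom \<Sigma> i. grad \<Sigma> i h x \<bullet> vf \<Sigma> i x = 0)"

definition conservative :: "'a::euclidean_space hds \<Rightarrow> (nat \<Rightarrow> 'a \<Rightarrow> real) \<Rightarrow> bool" where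
  "conservative \<Sigma> H \<longleftrightarrow>
    (\<forall>i < phases \<Sigma>.
      first_integral \<Sigma> i (H i) \<and> \<not> H i constant_on dom \<Sigma> i \<and>
      (\<forall>x \<in> event \<Sigma> i. H (next_phase \<Sigma> i) (reset \<Sigma> i x) = H i x))"

definition modified :: "'a::euclidean_space hds \<Rightarrow> (nat \<Rightarrow> 'a \<Rightarrow> real) \<Rightarrow> real \<Rightarrow> 'a hds" where
  "modified \<Sigma> H \<xi> = \<Sigma>\<lparr>vf := \<lambda>i x. vf \<Sigma> i x + \<xi> *\<^sub>R grad \<Sigma> i (H i) x\<rparr>"

definition modified_poincare_map ::
  "'a::euclidean_space hds \<Rightarrow> (nat \<Rightarrow> 'a \<Rightarrow> real) \<Rightarrow> 'a set \<Rightarrow> 'a \<Rightarrow> real \<Rightarrow> 'a" where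
  "modified_poincare_map \<Sigma> H A x0 \<xi> = poincare_map (modified \<Sigma> H \<xi>) A x0"

text \<open>
  H is non-trivial along the trajectory from x0 up to its arrival in A: dH does not vanish at
  every one of its points. This does not follow from H being non-constant on the domains, and it
  cannot be dropped when concluding xi = 0 from a fixed point. Example: one phase on R^2 with
  f = (1,0), event function 1 - x, reset (1,y) to (0,y), anchor 1/2 - x and H = y^2. Here
  (1/2,0) is a fixed point of the modified Poincare map for every xi, because dH = 0 on y = 0.
\<close>

definition nontrivial_along ::
  "'a::euclidean_space hds \<Rightarrow> (nat \<Rightarrow> 'a \<Rightarrow> real) \<Rightarrow> 'a set \<Rightarrow> 'a \<Rightarrow> bool" where
  "nontrivial_along \<Sigma> H A x0 \<longleftrightarrow>
    (\<exists>i < phases \<Sigma>. \<exists>t \<ge> 0. ereal t \<le> event_time \<Sigma> i (phase_start \<Sigma> x0 i) \<and>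
      grad \<Sigma> i (H i) (flow \<Sigma> i t (phase_start \<Sigma> x0 i)) \<noteq> 0) \<or>
    (\<exists>t \<ge> 0. ereal t \<le> hit_time \<Sigma> 0 A (return_state \<Sigma> x0) \<and>
      grad \<Sigma> 0 (H 0) (flow \<Sigma> 0 t (return_state \<Sigma> x0)) \<noteq> 0)"

end

theory Submission
  imports Defs
begin

text \<open>
  Along a trajectory of the modified phase dynamics the chain rule and
  \<open>dH f = 0\<close> give \<open>d/dt H = \<xi> |dH|\<^sup>2\<close>
  (\<open>first_integral_derivative_along_modified_solution\<close>). Hence \<open>\<xi> H\<close> is nondecreasing on every
  arc, and the resets preserve it, so it is nondecreasing along the whole hybrid trajectory. A
  fixed point of the modified map closes this trajectory, so \<open>\<xi> H\<close> is constant on every arc.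
  A function that is constant on a nondegenerate closed interval has derivative zero on all of
  it, end points included; therefore \<open>\<xi>\<^sup>2 |dH|\<^sup>2 = 0\<close> at every point of the trajectory
  (\<open>modified_flow_arc\<close>). As dH is nonzero somewhere on the trajectory, \<open>\<xi> = 0\<close>. For
  \<open>\<xi> = 0\<close> the modified system is the original one, which also settles the converse.

  Two points need care. First, gradients are definite descriptions, so existence and uniqueness
  have to be established (\<open>has_derivative_gradient\<close>). Secondly, the arc from the return state to
  the anchor may have length zero and then says nothing about dH; but in that case the return
  state is the fixed point x0 itself, where the first phase, of positive duration, starts.
\<close>

section \<open>Gradients on relatively open sets\<close>

text \<open>
  If v and w represent the same differential, then \<open>v - w\<close> is itself a direction in V, along
  which S contains a short segment through x. The derivative of g - g = 0 along it is
  \<open>|v - w|\<^sup>2\<close>.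
\<close>

lemma gradient_vector_unique:
  fixes g :: "'a::euclidean_space \<Rightarrow> real"
  assumes V: "subspace V" and S: "openin (top_of_set V) S" and x: "x \<in> S"
    and v: "v \<in> V" "(g has_derivative (\<lambda>h. v \<bullet> h)) (at x within S)"
    and w: "w \<in> V" "(g has_derivative (\<lambda>h. w \<bullet> h)) (at x within S)"
  shows "v = w"
proof -
  define d where "d = v - w"
  obtain U where U: "open U" "S = V \<inter> U"
    using S by (auto simp: openin_open)
  have dV: "d \<in> V" using v(1) w(1) V by (simp add: d_def subspace_diff)
  define c where "c = (\<lambda>t::real. x + t *\<^sub>R d)"
  define I where "I = c -` U"
  have cV: "c t \<in> V" for t
    using x U(2) dV V by (auto simp: c_def intro: subspace_add subspace_scale)
  have "open I"
    unfolding I_def c_def by (intro open_vimage U(1) continuous_intros)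
  moreover have "0 \<in> I" using x U(2) by (simp add: I_def c_def)
  ultimately have at0: "at 0 within I = at 0" by (rule at_within_open[rotated])
  have cI: "c ` I \<subseteq> S" using cV U(2) by (auto simp: I_def)
  have "((\<lambda>y. g y - g y) has_derivative (\<lambda>h. v \<bullet> h - w \<bullet> h)) (at x within S)"
    by (intro has_derivative_diff v w)
  then have "((\<lambda>_. 0::real) has_derivative (\<lambda>h. d \<bullet> h)) (at (c 0) within c ` I)"
    using has_derivative_subset[OF _ cI] by (simp add: d_def c_def inner_diff_left)
  moreover have "(c has_derivative (\<lambda>t. t *\<^sub>R d)) (at 0 within I)"
    unfolding c_def by (auto intro!: derivative_eq_intros)
  ultimately have "((\<lambda>_. 0::real) has_derivative (\<lambda>t. d \<bullet> (t *\<^sub>R d))) (at 0)"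
    using has_derivative_in_compose[of c "\<lambda>t. t *\<^sub>R d" 0 I "\<lambda>_. 0::real" "\<lambda>h. d \<bullet> h"]
    unfolding at0 by blast
  then have "((\<lambda>_. 0::real) has_real_derivative (d \<bullet> d)) (at 0)"
    by (simp add: has_field_derivative_def mult_commute_abs)
  then have "d \<bullet> d = 0"
    using DERIV_unique DERIV_const by blast
  then show ?thesis by (simp add: d_def)
qed

text \<open>
  A differential within S matters only on displacements \<open>y - x\<close> with y in S, which lie in V. It
  may thus be replaced by its restriction to V, represented by a vector of V in an orthonormal
  basis.
\<close>

lemma has_derivative_gradient:
  fixes g :: "'a::euclidean_space \<Rightarrow> real"
  assumes V: "subspace V" and S: "openin (top_of_set V) S" and x: "x \<in> S"
    and g: "C1_on S g"
  shows "(g has_derivative (\<lambda>h. gradient V S g x \<bullet> h)) (at x within S)"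
proof -
  obtain D where D: "(g has_derivative D) (at x within S)"
    using g x by (auto simp: C1_on_def)
  then have lin: "linear D" by (rule has_derivative_linear)
  obtain B where B: "B \<subseteq> V" "pairwise orthogonal B" "\<And>b. b \<in> B \<Longrightarrow> norm b = 1"
      "independent B" "span B = V"
    using orthonormal_basis_subspace[OF V] by metis
  have fin: "finite B" using B(4) by (rule independent_imp_finite)
  define v where "v = (\<Sum>b\<in>B. D b *\<^sub>R b)"
  have vV: "v \<in> V"
    unfolding v_def using B(1) by (auto intro!: subspace_sum[OF V] subspace_scale[OF V])
  have rep: "D h = v \<bullet> h" if "h \<in> V" for h
  proof -
    have "(\<Sum>b\<in>B. (h \<bullet> b) *\<^sub>R b) = h"
      using orthonormal_basis_expand[OF B(2,3), of h] that B(5) fin by simp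
    then have "D h = D (\<Sum>b\<in>B. (h \<bullet> b) *\<^sub>R b)" by simp
    also have "\<dots> = (\<Sum>b\<in>B. (h \<bullet> b) * D b)"
      by (simp add: linear_sum[OF lin] linear_scale[OF lin])
    also have "\<dots> = v \<bullet> h"
      by (simp add: v_def inner_sum_left inner_commute[of h] mult.commute)
    finally show ?thesis .
  qed
  have SV: "S \<subseteq> V" using S openin_imp_subset by blast
  have diff: "y - x \<in> V" if "y \<in> S" for y
    using that x SV V by (auto intro: subspace_diff)
  have v: "(g has_derivative (\<lambda>h. v \<bullet> h)) (at x within S)"
  proof (rule has_derivativeI_sandwich[where e = 1 and H = "\<lambda>y. norm (g y - g x - D (y - x)) / norm (y - x)"])
    show "bounded_linear (\<lambda>h. v \<bullet> h)" by (rule bounded_linear_inner_right)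
    show "((\<lambda>y. norm (g y - g x - D (y - x)) / norm (y - x)) \<longlongrightarrow> 0) (at x within S)"
      using D by (simp add: has_derivative_iff_norm)
  qed (use diff rep in auto)
  have "gradient V S g x \<in> V \<and>
    (g has_derivative (\<lambda>h. gradient V S g x \<bullet> h)) (at x within S)"
    unfolding gradient_def
    by (rule theI) (use vV v gradient_vector_unique[OF V S x] in blast)+
  then show ?thesis by blast
qed

section \<open>Monotone functions on a closed interval\<close>

text \<open>
  On a nondegenerate interval one-sided derivatives at the end points are unique, so a constant
  function has derivative zero there as well.
\<close>

lemma nonneg_derivative_closed_interval:
  fixes f f' :: "real \<Rightarrow> real"
  assumes "a \<le> b"
    and f: "\<And>t. t \<in> {a..b} \<Longrightarrow> (f has_real_derivative f' t) (at t within {a..b})"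
    and pos: "\<And>t. t \<in> {a..b} \<Longrightarrow> 0 \<le> f' t"
  shows "f a \<le> f b"
    and "a < b \<Longrightarrow> f a = f b \<Longrightarrow> t \<in> {a..b} \<Longrightarrow> f' t = 0"
proof -
  have cont: "continuous_on {a..b} f"
    using f by (meson DERIV_continuous continuous_on_eq_continuous_within)
  have mono: "f s \<le> f t" if "a \<le> s" "s \<le> t" "t \<le> b" for s t
  proof (rule DERIV_nonneg_imp_increasing_open[OF that(2)])
    show "continuous_on {s..t} f"
      using that by (intro continuous_on_subset[OF cont]) auto
    show "\<exists>y. (f has_real_derivative y) (at r) \<and> 0 \<le> y" if r: "s < r" "r < t" for r
    proof -
      have "r \<in> interior {a..b}" using r \<open>a \<le> s\<close> \<open>t \<le> b\<close> by simp
      then show ?thesis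
        using f[of r] pos[of r] at_within_interior[of r "{a..b}"] interior_subset by fastforce
    qed
  qed
  show "f a \<le> f b" using mono \<open>a \<le> b\<close> by simp
  assume "a < b" "f a = f b" and t: "t \<in> {a..b}"
  then have "f s = f a" if "s \<in> {a..b}" for s
    using mono[of a s] mono[of s b] that by simp
  then have "((\<lambda>_. f a) has_real_derivative f' t) (at t within {a..b})"
    using f[OF t] has_derivative_transform[OF t, of "\<lambda>_. f a" f] unfolding has_field_derivative_def
    by metis
  moreover have "((\<lambda>_. f a) has_real_derivative 0) (at t within {a..b})" by simp
  ultimately show "f' t = 0"
    using vector_derivative_unique_within_closed_interval[of a b t "\<lambda>_. f a" "f' t" 0] \<open>a < b\<close> t
    by (simp add: has_real_derivative_iff_has_vector_derivative)
qed

section \<open>Flows as solutions\<close>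

lemma flow_eq_solution:
  assumes "unique_until \<Sigma> i x \<tau>" "solution \<Sigma> i x T u" "0 \<le> t" "t < T" "ereal t \<le> \<tau>"
  shows "flow \<Sigma> i t x = u t"
  unfolding flow_def using assms unfolding unique_until_def by (intro the_equality) blast+

lemma solution_beyond:
  assumes "ereal t < max_time \<Sigma> i x"
  obtains T u where "solution \<Sigma> i x T u" "t < T"
  using assms unfolding max_time_def by (auto simp: less_SUP_iff)

lemma hit_time_nonneg: "0 \<le> hit_time \<Sigma> i S x"
  unfolding hit_time_def by (auto intro!: INF_greatest)

lemma hit_time_less_imp_less_max_time:
  assumes "hit_time \<Sigma> i S x < \<tau>"
  shows "hit_time \<Sigma> i S x < max_time \<Sigma> i x"
proof -
  obtain t where "0 \<le> t" "ereal t < max_time \<Sigma> i x" "flow \<Sigma> i t x \<in> S"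
    using assms unfolding hit_time_def by (auto simp: INF_less_iff)
  then have "hit_time \<Sigma> i S x \<le> ereal t"
    unfolding hit_time_def by (intro INF_lower) auto
  then show ?thesis using \<open>ereal t < max_time \<Sigma> i x\<close> by (rule order_le_less_trans)
qed

section \<open>The first integral along the modified dynamics\<close>

lemma modified_simps [simp]:
  "phases (modified \<Sigma> H \<xi>) = phases \<Sigma>"
  "dom (modified \<Sigma> H \<xi>) = dom \<Sigma>"
  "event (modified \<Sigma> H \<xi>) = event \<Sigma>"
  "reset (modified \<Sigma> H \<xi>) = reset \<Sigma>"
  "grad (modified \<Sigma> H \<xi>) = grad \<Sigma>"
  by (simp_all add: modified_def grad_def fun_eq_iff)

lemma modified_0 [simp]: "modified \<Sigma> H 0 = \<Sigma>"
  by (simp add: modified_def)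

lemma first_integral_derivative_along_modified_solution:
  assumes sys: "hybrid_system \<Sigma> e" and cons: "conservative \<Sigma> H" and i: "i < phases \<Sigma>"
    and sol: "solution (modified \<Sigma> H \<xi>) i x T u" and t: "t \<in> {0..<T}"
  shows "((\<lambda>t. H i (u t)) has_real_derivative \<xi> * (norm (grad \<Sigma> i (H i) (u t)))\<^sup>2)
    (at t within {0..<T})"
proof -
  let ?G = "grad \<Sigma> i (H i) (u t)"
  have ut: "u ` {0..<T} \<subseteq> dom \<Sigma> i"
    and u: "(u has_vector_derivative vf \<Sigma> i (u t) + \<xi> *\<^sub>R ?G) (at t within {0..<T})"
    using sol t by (auto simp: solution_def modified_def)
  have fi: "first_integral \<Sigma> i (H i)" using cons i by (simp add: conservative_def)
  have x: "u t \<in> dom \<Sigma> i" using ut t by blast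
  have "(H i has_derivative (\<lambda>h. ?G \<bullet> h)) (at (u t) within dom \<Sigma> i)"
    unfolding grad_def
    by (rule has_derivative_gradient)
      (use sys i fi x in \<open>auto simp: hybrid_system_def first_integral_def\<close>)
  then have "((\<lambda>t. H i (u t)) has_derivative
      (\<lambda>s. ?G \<bullet> (s *\<^sub>R (vf \<Sigma> i (u t) + \<xi> *\<^sub>R ?G)))) (at t within {0..<T})"
    using has_derivative_in_compose[OF u[unfolded has_vector_derivative_def]
        has_derivative_subset[OF _ ut]] by blast
  moreover have "?G \<bullet> vf \<Sigma> i (u t) = 0"
    using fi x by (simp add: first_integral_def)
  then have "(\<lambda>s. ?G \<bullet> (s *\<^sub>R (vf \<Sigma> i (u t) + \<xi> *\<^sub>R ?G))) = (*) (\<xi> * (norm ?G)\<^sup>2)"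
    by (auto simp: fun_eq_iff inner_add_right power2_norm_eq_inner)
  ultimately show ?thesis by (simp add: has_field_derivative_def)
qed

text \<open>
  Multiplying H by \<open>\<xi>\<close> makes the derivative \<open>\<xi>\<^sup>2 |dH|\<^sup>2\<close> nonnegative for either sign of
  \<open>\<xi>\<close>.
\<close>

lemma modified_flow_arc:
  assumes sys: "hybrid_system \<Sigma> e" and cons: "conservative \<Sigma> H" and i: "i < phases \<Sigma>"
    and uniq: "unique_until (modified \<Sigma> H \<xi>) i x \<tau>" and s\<tau>: "ereal s \<le> \<tau>"
    and smax: "ereal s < max_time (modified \<Sigma> H \<xi>) i x" and s: "0 \<le> s"
  shows "flow (modified \<Sigma> H \<xi>) i 0 x = x"
    and "\<xi> * H i x \<le> \<xi> * H i (flow (modified \<Sigma> H \<xi>) i s x)"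
    and "\<xi> \<noteq> 0 \<Longrightarrow> 0 < s \<Longrightarrow> \<xi> * H i x = \<xi> * H i (flow (modified \<Sigma> H \<xi>) i s x) \<Longrightarrow>
      t \<in> {0..s} \<Longrightarrow> grad \<Sigma> i (H i) (flow (modified \<Sigma> H \<xi>) i t x) = 0"
proof -
  let ?M = "modified \<Sigma> H \<xi>"
  obtain T u where sol: "solution ?M i x T u" and sT: "s < T"
    using smax by (rule solution_beyond)
  have flow: "flow ?M i t x = u t" if "t \<in> {0..s}" for t
  proof (rule flow_eq_solution[OF uniq sol])
    show "ereal t \<le> \<tau>" using that s\<tau> by (meson atLeastAtMost_iff ereal_less_eq(3) order_trans)
  qed (use that sT in auto)
  have u0: "u 0 = x" using sol by (simp add: solution_def)
  show "flow ?M i 0 x = x" using flow[of 0] s u0 by simp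
  let ?f = "\<lambda>t. \<xi> * H i (u t)"
  let ?f' = "\<lambda>t. \<xi> * (\<xi> * (norm (grad \<Sigma> i (H i) (u t)))\<^sup>2)"
  have der: "(?f has_real_derivative ?f' t) (at t within {0..s})" if "t \<in> {0..s}" for t
    using first_integral_derivative_along_modified_solution[OF sys cons i sol, of t] that sT
    by (intro DERIV_cmult) (auto elim: DERIV_subset)
  have pos: "0 \<le> ?f' t" for t
    by (simp flip: mult.assoc)
  show "\<xi> * H i x \<le> \<xi> * H i (flow ?M i s x)"
    using nonneg_derivative_closed_interval(1)[of 0 s ?f ?f', OF s der pos] flow[of s] u0 s by simp
  assume "\<xi> \<noteq> 0" "0 < s" "\<xi> * H i x = \<xi> * H i (flow ?M i s x)" and t: "t \<in> {0..s}"
  then have "?f' t = 0"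
    using nonneg_derivative_closed_interval(2)[of 0 s ?f ?f', OF s der pos] flow[of s] u0 s by simp
  then show "grad \<Sigma> i (H i) (flow ?M i t x) = 0"
    using flow[OF t] \<open>\<xi> \<noteq> 0\<close> by simp
qed

section \<open>Closed trajectories of the modified system\<close>

lemma modified_fixed_point_imp_zero:
  assumes sys: "hybrid_system \<Sigma> e" and cons: "conservative \<Sigma> H"
    and def: "poincare_defined (modified \<Sigma> H \<xi>) e A x0"
    and nontriv: "nontrivial_along (modified \<Sigma> H \<xi>) H A x0"
    and fixed: "poincare_map (modified \<Sigma> H \<xi>) A x0 = x0"
  shows "\<xi> = 0"
proof (rule ccontr)
  assume \<xi>: "\<xi> \<noteq> 0"
  define M where "M = modified \<Sigma> H \<xi>"
  define m where "m = phases \<Sigma>"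
  define p where "p = phase_start M x0"
  define r where "r = return_state M x0"
  define \<tau> where "\<tau> i = real_of_ereal (event_time M i (p i))" for i
  note arc = modified_flow_arc[OF sys cons, of _ \<xi>, folded M_def m_def]
  have m: "0 < m" using sys by (simp add: hybrid_system_def m_def)
  have p0: "p 0 = x0" and pm: "p m = r"
    by (simp_all add: p_def r_def return_state_def M_def m_def)
  have phase: "unique_until M i (p i) (ereal (\<tau> i)) \<and> 0 < \<tau> i \<and>
      ereal (\<tau> i) < max_time M i (p i) \<and> event_time M i (p i) = ereal (\<tau> i) \<and>
      flow M i (\<tau> i) (p i) \<in> event \<Sigma> i" if "i < m" for i
  proof -
    have *: "unique_until M i (p i) (event_time M i (p i))"
      "0 < event_time M i (p i)" "event_time M i (p i) < max_time M i (p i)"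
      "event_state M i (p i) \<in> event \<Sigma> i"
      using def that by (auto simp: poincare_defined_def M_def[symmetric] m_def p_def Let_def)
        (simp_all add: M_def)
    then have "event_time M i (p i) = ereal (\<tau> i)"
      unfolding \<tau>_def by (cases "event_time M i (p i)") auto
    with * show ?thesis by (auto simp: event_state_def \<tau>_def[symmetric])
  qed
  have p_Suc: "p (Suc i) = reset \<Sigma> i (flow M i (\<tau> i) (p i))" for i
    by (simp add: p_def event_state_def \<tau>_def) (simp add: M_def)

  \<comment> \<open>Reduction modulo m lets the return state, with index m, be measured by the first integral
    of phase 0.\<close>
  define E where "E i = \<xi> * H (i mod m) (p i)" for i
  have E_Suc: "E (Suc i) = \<xi> * H i (flow M i (\<tau> i) (p i))" if "i < m" for i
    using phase[OF that] cons that by (simp add: E_def p_Suc conservative_def next_phase_def m_def)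
  have E_le: "E i \<le> E (Suc i)" if "i < m" for i
    unfolding E_Suc[OF that]
    using arc(2)[OF that, of "p i" "ereal (\<tau> i)" "\<tau> i"] phase[OF that] that
    by (simp add: E_def)
  have E_mono: "E i \<le> E j" if "i \<le> j" "j \<le> m" for i j
    using that
  proof (induction j rule: dec_induct)
    case (step k)
    then show ?case using E_le[of k] by linarith
  qed simp

  \<comment> \<open>The final arc, from the return state to the anchor.\<close>
  define s where "s = real_of_ereal (hit_time M 0 A r)"
  define q where "q = real_of_ereal (total_event_time M x0)"
  have "total_event_time M x0 = (\<Sum>i<m. ereal (\<tau> i))"
    using phase by (simp add: total_event_time_def p_def[symmetric] m_def M_def[symmetric])
      (simp add: M_def)
  then have total: "total_event_time M x0 = ereal q" by (simp add: q_def)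
  have uniq_r: "unique_until M 0 r (event_time M 0 r)"
    and "hit_time M 0 A r + ereal q < ereal q + event_time M 0 r"
    using def total by (auto simp: poincare_defined_def M_def[symmetric] r_def anchor_time_def)
  then have hit_less: "hit_time M 0 A r < event_time M 0 r"
    by (metis add.commute ereal_add_strict_mono2 not_less ereal_less_add add_left_mono)
  then have hit_max: "hit_time M 0 A r < max_time M 0 r"
    by (rule hit_time_less_imp_less_max_time)
  have hit: "hit_time M 0 A r = ereal s" and s: "0 \<le> s"
    using hit_less hit_time_nonneg[of M 0 A r] unfolding s_def
    by (cases "hit_time M 0 A r"; auto)+
  have "ereal s \<le> event_time M 0 r" using hit hit_less by simp
  note final = arc[OF m uniq_r this hit_max[unfolded hit] s]
  have "poincare_map M A x0 = flow M 0 s r"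
    by (simp add: poincare_map_def recurrent_flow_def anchor_time_def total hit r_def[symmetric])
  then have closed: "flow M 0 s r = x0" using fixed by (simp add: M_def)

  have Em: "E m \<le> E 0" using final(2) closed by (simp add: E_def p0 pm)
  have E_eq: "E i = E 0" if "i \<le> m" for i
    using E_mono[of 0 i] E_mono[of i m] Em that by simp
  have dead: "grad \<Sigma> i (H i) (flow M i t (p i)) = 0" if "i < m" "t \<in> {0..\<tau> i}" for i t
    using arc(3)[OF that(1), of "p i" "ereal (\<tau> i)" "\<tau> i" t] phase[OF that(1)] \<xi> that
      E_Suc[OF that(1)] E_eq[of i] E_eq[of "Suc i"] by (simp add: E_def)
  have dead_final: "grad \<Sigma> 0 (H 0) (flow M 0 t r) = 0" if "t \<in> {0..s}" for t
  proof (cases "s = 0")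
    case True
    \<comment> \<open>The return state is the fixed point, where the first phase starts.\<close>
    then have "flow M 0 t r = flow M 0 0 (p 0)"
      using that closed final(1) p0
        arc(1)[OF m, of "p 0" "ereal (\<tau> 0)" "\<tau> 0"] phase[OF m] by simp
    then show ?thesis using dead[OF m, of 0] phase[OF m] by simp
  next
    case False
    then show ?thesis
      using final(3)[OF \<xi> _ _ that] s closed E_eq[of m] by (simp add: E_def p0 pm)
  qed
  show False
    using nontriv phase dead dead_final hit
    unfolding nontrivial_along_def M_def[symmetric] p_def[symmetric] r_def[symmetric]
    by (auto simp: m_def M_def)
qed

theorem theorem3p1:
  fixes \<Sigma> :: "'a::euclidean_space hds"
    and e H :: "nat \<Rightarrow> 'a \<Rightarrow> real" and a :: "'a \<Rightarrow> real" and x0 :: 'a and \<xi> :: real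
  assumes "hybrid_system \<Sigma> e"
    and "resets_avoid_events \<Sigma>"
    and "conservative \<Sigma> H"
    and "anchor \<Sigma> e a"
    and "poincare_defined (modified \<Sigma> H \<xi>) e (anchor_set \<Sigma> a) x0"
    and "nontrivial_along (modified \<Sigma> H \<xi>) H (anchor_set \<Sigma> a) x0"
  shows "modified_poincare_map \<Sigma> H (anchor_set \<Sigma> a) x0 \<xi> = x0 \<longleftrightarrow>
    \<xi> = 0 \<and> poincare_map \<Sigma> (anchor_set \<Sigma> a) x0 = x0"
  using modified_fixed_point_imp_zero[OF assms(1,3,5,6)]
  by (auto simp: modified_poincare_map_def)

end
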